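(* Let $X$ be a countably infinite set and $\mathcal{P} = \{\Sigma_0, \dots, \Sigma_{n-1}\}$ a finite partition of $X$ into $n \geq 2$ parts such that $|\Sigma_i| = |X|$ for all $i \in n$. Then there exists a unique maximal inverse subsemigroup of $I_X$ which contains $\operatorname{Stab}(\mathcal{P})$ but not $\operatorname{Sym}(X)$, namely $$\mathcal{A}_{\mathcal{P}} = \{ f \in I_X \mid \rho_f \in \operatorname{Sym}(n), \text{ or } (\operatorname{dom}(\rho_f) \neq n \text{ and } \operatorname{im}(\rho_f) \neq n) \}.$$
   Context: For a set $X$, $I_X$ is the symmetric inverse monoid: the set of all bijections between subsets of $X$ (partial bijections, called charts) under composition of partial functions, written left to right (the image of $x$ under $f$ is $xf$). For $\Sigma \subseteq X$, $\Sigma f = \{ xf \mid x \in \Sigma \cap \operatorname{dom}(f)\}$. $\operatorname{Sym}(X) \subseteq I_X$ is the group of all permutations of $X$. A natural number $n$ is identified with $\{0,1,\dots,n-1\}$. $\operatorname{Stab}(\mathcal{P}) = \{ f \in \operatorname{Sym}(X) \mid (\forall i \in n)(\exists j \in n)\ \Sigma_i f = \Sigma_j \}$. For $f \in I_X$, $\rho_f = \{ (i,j) \in n \times n \mid |\Sigma_i f \cap \Sigma_j| = |X| \}$, a binary relation on $n$; $\operatorname{dom}(\rho_f)=\{i : \exists j\,(i,j)\in\rho_f\}$, $\operatorname{im}(\rho_f)=\{j : \exists i\,(i,j)\in\rho_f\}$, and $\rho_f \in \operatorname{Sym}(n)$ means that $\rho_f$ is (the graph of) a permutation of $n$. An inverse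 subsemigroup of $I_X$ is a subsemigroup closed under $f\mapsto f^{-1}$; a maximal inverse subsemigroup of $I_X$ is a proper inverse subsemigroup that is maximal under containment among the proper inverse subsemigroups of $I_X$. *)

theory Defs
  imports Main "HOL-Library.Countable_Set" "HOL-Library.Equipollence" "HOL-Library.Disjoint_Sets"
begin

text \<open>
  A chart is identified with its graph. Relations then supply the operations in the
  left-to-right convention: \<open>f O g\<close> is ``first f, then g'', \<open>f\<inverse>\<close> is the inverse chart, and
  \<open>f `` A\<close> is the image \<open>A f\<close>, that is, the set of all \<open>x f\<close> with \<open>x \<in> A \<inter> Domain f\<close>.
\<close>

definition sym_inv_monoid :: "'a set \<Rightarrow> 'a rel set" where
  "sym_inv_monoid X = {f. f \<subseteq> X \<times> X \<and> single_valued f \<and> single_valued (f\<inverse>)}"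

definition sym_group :: "'a set \<Rightarrow> 'a rel set" where
  "sym_group X = {f \<in> sym_inv_monoid X. Domain f = X \<and> Range f = X}"

definition inverse_subsemigroup :: "'a set \<Rightarrow> 'a rel set \<Rightarrow> bool" where
  "inverse_subsemigroup X S \<longleftrightarrow>
     S \<subseteq> sym_inv_monoid X \<and> (\<forall>f\<in>S. \<forall>g\<in>S. f O g \<in> S) \<and> (\<forall>f\<in>S. f\<inverse> \<in> S)"

definition maximal_inverse_subsemigroup :: "'a set \<Rightarrow> 'a rel set \<Rightarrow> bool" where
  "maximal_inverse_subsemigroup X M \<longleftrightarrow>
     inverse_subsemigroup X M \<and> M \<noteq> sym_inv_monoid X \<and>
     (\<forall>N. inverse_subsemigroup X N \<and> N \<noteq> sym_inv_monoid X \<and> M \<subseteq> N \<longrightarrow> N = M)"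

text \<open>
  A partition into \<open>n\<close> parts is given as an indexed family \<open>P 0, \<dots>, P (n - 1)\<close>; the values of
  \<open>P\<close> at indices \<open>\<ge> n\<close> are never used. The natural number \<open>n\<close>, as a set, is \<open>{..<n}\<close>.
\<close>

definition is_partition :: "'a set \<Rightarrow> nat \<Rightarrow> (nat \<Rightarrow> 'a set) \<Rightarrow> bool" where
  "is_partition X n P \<longleftrightarrow>
     (\<Union>i<n. P i) = X \<and> disjoint_family_on P {..<n} \<and> (\<forall>i<n. P i \<noteq> {})"

definition Stab :: "'a set \<Rightarrow> nat \<Rightarrow> (nat \<Rightarrow> 'a set) \<Rightarrow> 'a rel set" where
  "Stab X n P = {f \<in> sym_group X. \<forall>i<n. \<exists>j<n. f `` P i = P j}"

definition rho :: "'a set \<Rightarrow> nat \<Rightarrow> (nat \<Rightarrow> 'a set) \<Rightarrow> 'a rel \<Rightarrow> nat rel" where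
  "rho X n P f = {(i, j). i < n \<and> j < n \<and> f `` P i \<inter> P j \<approx> X}"

definition A_part :: "'a set \<Rightarrow> nat \<Rightarrow> (nat \<Rightarrow> 'a set) \<Rightarrow> 'a rel set" where
  "A_part X n P = {f \<in> sym_inv_monoid X.
     rho X n P f \<in> sym_group {..<n} \<or>
     (Domain (rho X n P f) \<noteq> {..<n} \<and> Range (rho X n P f) \<noteq> {..<n})}"

end

theory Submission
  imports Defs
begin

text \<open>
  For an inverse subsemigroup \<open>M\<close> containing the stabiliser, call \<open>D \<subseteq> X\<close> absorbed if some element
  of \<open>M\<close> is defined on \<open>D\<close> and maps \<open>D\<close> onto a subset of \<open>P 0\<close> with infinite complement in \<open>P 0\<close>.
  Every permutation of such an image extends to an element of the stabiliser, so \<open>M\<close> contains \<open>Sym(X)\<close> as soon as \<open>X\<close>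
  itself is absorbed. An element \<open>f\<close> of \<open>M\<close> outside \<open>\<A>\<^sub>P\<close> may be taken with \<open>\<rho>\<^sub>f\<close> total, and then
  \<open>\<rho>\<^sub>f\<close> contains a noninjective function; pulling back along \<open>f\<close> repeatedly shows that every set
  that is coinfinite in each part is absorbed.

  If \<open>M\<close> properly contains \<open>\<A>\<^sub>P\<close>, then it contains a total chart with coinfinite image in each part, so \<open>X\<close>
  is absorbed, and conjugating into \<open>P 0\<close> shows that \<open>M\<close> contains every chart. If instead \<open>M\<close> is
  maximal without containing \<open>Sym(X)\<close>, then \<open>M\<close> contains a chart with cofinite domain and
  coinfinite image, since otherwise it would equal the subsemigroup of charts having both or
  neither; this makes some cofinite set absorbed. Likewise it contains a total chart that is not
  surjective, and that enlarges the absorbed cofinite set point by point to \<open>X\<close>, a contradiction.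
\<close>

section \<open>Countably infinite sets and charts\<close>

lemma infinite_split:
  assumes "infinite A"
  obtains B where "B \<subseteq> A" "infinite B" "infinite (A - B)"
proof -
  obtain C :: "nat \<Rightarrow> 'a set" where C: "pairwise (\<lambda>i j. disjnt (C i) (C j)) UNIV"
    "(\<Union>i. C i) \<subseteq> A" "\<And>i. infinite (C i)"
    using infinite_infinite_partition[OF assms] by metis
  have "C 0 \<inter> C 1 = {}"
    using C(1) by (auto simp: pairwise_def disjnt_def)
  then have "C 1 \<subseteq> A - C 0"
    using C(2) by blast
  then show thesis
    using that[of "C 0"] C(2,3) finite_subset by blast
qed

lemma countable_infinite_bij_betw:
  assumes "countable S" "infinite S" "countable T" "infinite T"
  obtains h where "bij_betw h S T"
  using bij_betw_trans[OF to_nat_on_infinite[OF assms(1,2)] bij_betw_from_nat_into[OF assms(3,4)]]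
    that by blast

lemma countable_infinite_inj_into:
  assumes "countable S" "infinite T"
  obtains h where "inj_on h S" "h ` S \<subseteq> T"
proof -
  obtain f :: "nat \<Rightarrow> 'b" where f: "inj f" "range f \<subseteq> T"
    using infinite_countable_subset[OF assms(2)] by blast
  obtain g :: "'a \<Rightarrow> nat" where g: "inj_on g S"
    using assms(1) by (auto simp: countable_def)
  show thesis
    using that[of "f \<circ> g"] f g by (auto intro!: comp_inj_on inj_on_subset[OF f(1)])
qed

text \<open>The two complements are countably infinite, hence equinumerous, and any bijection
  between them completes \<open>g\<close>.\<close>

lemma extend_to_bij_betw:
  assumes "countable S" "countable T" "A \<subseteq> S" "inj_on g A" "g ` A \<subseteq> T"
    and "infinite (S - A)" "infinite (T - g ` A)"
  obtains h where "bij_betw h S T" "\<And>x. x \<in> A \<Longrightarrow> h x = g x"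
proof -
  obtain k where k: "bij_betw k (S - A) (T - g ` A)"
    using countable_infinite_bij_betw assms(1,2,6,7) countable_Diff by metis
  let ?h = "\<lambda>x. if x \<in> A then g x else k x"
  have "bij_betw ?h A (g ` A)"
    using assms(4) by (auto simp: bij_betw_def inj_on_def)
  moreover have "bij_betw ?h (S - A) (T - g ` A)"
    using k by (rule bij_betw_cong[THEN iffD1, rotated]) auto
  ultimately have "bij_betw ?h (A \<union> (S - A)) (g ` A \<union> (T - g ` A))"
    by (rule bij_betw_combine) blast
  then have "bij_betw ?h S T"
    using assms(3,5) by (simp add: Un_absorb1 Un_Diff_cancel)
  then show thesis
    using that by simp
qed

section \<open>Elementary facts on charts as relations\<close>

lemma chart_comp:
  assumes "f \<in> sym_inv_monoid X" "g \<in> sym_inv_monoid X"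
  shows "f O g \<in> sym_inv_monoid X"
  using assms unfolding sym_inv_monoid_def single_valued_def by blast

lemma chart_converse: "f \<in> sym_inv_monoid X \<Longrightarrow> f\<inverse> \<in> sym_inv_monoid X"
  unfolding sym_inv_monoid_def by auto

lemma chart_graph:
  assumes "inj_on h A" "A \<subseteq> X" "h ` A \<subseteq> X"
  shows "(\<lambda>x. (x, h x)) ` A \<in> sym_inv_monoid X"
  using assms unfolding sym_inv_monoid_def single_valued_def inj_on_def by blast

lemma chart_fun: "f \<in> sym_inv_monoid X \<Longrightarrow> (x, y) \<in> f \<Longrightarrow> (x, z) \<in> f \<Longrightarrow> y = z"
  and chart_inj: "f \<in> sym_inv_monoid X \<Longrightarrow> (x, z) \<in> f \<Longrightarrow> (y, z) \<in> f \<Longrightarrow> x = y"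
  and chart_dom: "f \<in> sym_inv_monoid X \<Longrightarrow> (x, y) \<in> f \<Longrightarrow> x \<in> X"
  and chart_ran: "f \<in> sym_inv_monoid X \<Longrightarrow> (x, y) \<in> f \<Longrightarrow> y \<in> X"
  unfolding sym_inv_monoid_def single_valued_def by blast+

lemma finite_single_valued_Image:
  assumes "single_valued f" "finite A"
  shows "finite (f `` A)"
proof -
  have "f `` A \<subseteq> (\<lambda>x. THE y. (x, y) \<in> f) ` A"
  proof
    fix y
    assume "y \<in> f `` A"
    then obtain x where x: "x \<in> A" "(x, y) \<in> f"
      by blast
    then have "(THE y. (x, y) \<in> f) = y"
      using assms(1) by (intro the_equality) (auto dest: single_valuedD)
    then show "y \<in> (\<lambda>x. THE y. (x, y) \<in> f) ` A"
      using x(1) by force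
  qed
  then show ?thesis
    using assms(2) finite_surj by blast
qed

lemma finite_chart_Image: "f \<in> sym_inv_monoid X \<Longrightarrow> finite A \<Longrightarrow> finite (f `` A)"
  by (rule finite_single_valued_Image) (auto simp: sym_inv_monoid_def)

lemma infinite_chart_Image:
  assumes "f \<in> sym_inv_monoid X" "infinite A" "A \<subseteq> Domain f"
  shows "infinite (f `` A)"
proof
  assume "finite (f `` A)"
  then have "finite (f\<inverse> `` f `` A)"
    by (rule finite_chart_Image[OF chart_converse[OF assms(1)]])
  moreover have "A \<subseteq> f\<inverse> `` f `` A"
    using assms(3) by blast
  ultimately show False
    using assms(2) finite_subset by blast
qed

lemma sym_group_graph:
  assumes "bij_betw h X X"
  shows "(\<lambda>x. (x, h x)) ` X \<in> sym_group X"
proof -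
  have "Range ((\<lambda>x. (x, h x)) ` X) = h ` X" "Domain ((\<lambda>x. (x, h x)) ` X) = X"
    by auto
  then show ?thesis
    using assms chart_graph[of h X X] unfolding sym_group_def bij_betw_def by simp
qed

text \<open>Lets the cardinality condition in \<open>rho\<close> be read as plain
  infinitude.\<close>

lemma eqpoll_countable_iff:
  assumes "countable X" "infinite X" "Y \<subseteq> X"
  shows "Y \<approx> X \<longleftrightarrow> infinite Y"
proof
  assume "infinite Y"
  then obtain h where "bij_betw h Y X"
    using countable_infinite_bij_betw[OF countable_subset[OF assms(3,1)] _ assms(1,2)] by metis
  then show "Y \<approx> X"
    unfolding eqpoll_def by blast
next
  assume "Y \<approx> X"
  then show "infinite Y"
    using assms(2) eqpoll_finite_iff[of Y X] by simp
qed

lemma inverse_subsemigroupD: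
  assumes "inverse_subsemigroup X M"
  shows "f \<in> M \<Longrightarrow> f \<in> sym_inv_monoid X"
    and "f \<in> M \<Longrightarrow> g \<in> M \<Longrightarrow> f O g \<in> M"
    and "f \<in> M \<Longrightarrow> f\<inverse> \<in> M"
  using assms unfolding inverse_subsemigroup_def by auto

text \<open>Passes from a graph to a function, the form in which the extension and cardinality
  lemmas take their maps.\<close>

lemma chart_function:
  assumes "f \<in> sym_inv_monoid X"
  obtains g where "\<And>x. x \<in> Domain f \<Longrightarrow> (x, g x) \<in> f" "inj_on g (Domain f)" "g ` Domain f = Range f"
proof -
  have "\<forall>x\<in>Domain f. \<exists>y. (x, y) \<in> f"
    by blast
  then obtain g where g: "\<And>x. x \<in> Domain f \<Longrightarrow> (x, g x) \<in> f"
    by metis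
  moreover have "inj_on g (Domain f)"
    using g chart_inj[OF assms] by (metis inj_onI)
  moreover have "g ` Domain f = Range f"
    using g chart_fun[OF assms] by (fastforce simp: image_iff)
  ultimately show thesis
    using that by blast
qed

text \<open>\<open>f\<close> restricts to a bijection from the points of \<open>A\<close> that it
  sends into \<open>B\<close> onto the set on the left. Pairs in \<open>rho\<close> can thus be
  tested on either side of \<open>f\<close>.\<close>

lemma infinite_chart_Image_Int:
  assumes "f \<in> sym_inv_monoid X"
  shows "infinite (f `` A \<inter> B) \<longleftrightarrow> infinite (A \<inter> f\<inverse> `` B)"
proof -
  have "f `` A \<inter> B = f `` (A \<inter> f\<inverse> `` B)"
    using chart_fun[OF assms] by blast
  then show ?thesis
    using finite_chart_Image[OF assms, of "A \<inter> f\<inverse> `` B"]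
      infinite_chart_Image[OF assms, of "A \<inter> f\<inverse> `` B"] by auto
qed

lemma sym_group_converse: "f \<in> sym_group X \<Longrightarrow> f\<inverse> \<in> sym_group X"
  unfolding sym_group_def sym_inv_monoid_def by auto

lemma sym_group_comp: "f \<in> sym_group X \<Longrightarrow> g \<in> sym_group X \<Longrightarrow> f O g \<in> sym_group X"
  unfolding sym_group_def using chart_comp[of f X g] by blast

section \<open>Relations and functions on a finite set\<close>

text \<open>If all selections were injective, finiteness would make one of them, \<phi>, a
  permutation. Exchanging one of its values for another \<open>j\<close> related to the same index
  would collide with the index that \<phi> already sends to \<open>j\<close>; so \<rho> would be the
  graph of \<phi>.\<close>

lemma noninjective_selection:
  fixes \<rho> :: "nat rel"
  assumes sub: "\<rho> \<subseteq> {..<n} \<times> {..<n}" and dom: "Domain \<rho> = {..<n}"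
    and nperm: "\<rho> \<notin> sym_group {..<n}"
  shows "\<exists>\<phi>. (\<forall>i<n. (i, \<phi> i) \<in> \<rho>) \<and> \<not> inj_on \<phi> {..<n}"
proof (rule ccontr)
  assume no: "\<not> ?thesis"
  have inj: "inj_on \<phi> {..<n}" if "\<And>i. i < n \<Longrightarrow> (i, \<phi> i) \<in> \<rho>" for \<phi>
    using no that by blast
  have "\<forall>i\<in>{..<n}. \<exists>j. (i, j) \<in> \<rho>"
    using dom by blast
  then obtain \<phi> where \<phi>: "\<And>i. i < n \<Longrightarrow> (i, \<phi> i) \<in> \<rho>"
    by (metis lessThan_iff)
  have "\<phi> ` {..<n} \<subseteq> {..<n}"
    using \<phi> sub by blast
  then have im: "\<phi> ` {..<n} = {..<n}"
    using inj[of \<phi>] \<phi> by (simp add: endo_inj_surj)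
  have "j = \<phi> i" if ij: "(i, j) \<in> \<rho>" for i j
  proof (rule ccontr)
    assume "j \<noteq> \<phi> i"
    have "i < n" "j < n"
      using ij sub by auto
    then obtain i' where i': "i' < n" "j = \<phi> i'"
      using im by blast
    have "inj_on (\<phi>(i := j)) {..<n}"
      by (rule inj) (use \<phi> ij in auto)
    then show False
      using i' \<open>i < n\<close> \<open>j \<noteq> \<phi> i\<close> by (auto simp: inj_on_def split: if_splits)
  qed
  then have "\<rho> = (\<lambda>i. (i, \<phi> i)) ` {..<n}"
    using \<phi> sub by auto
  moreover have "bij_betw \<phi> {..<n} {..<n}"
    using inj[of \<phi>] \<phi> im by (simp add: bij_betw_def)
  ultimately show False
    using nperm sym_group_graph by metis
qed

text \<open>If the image of \<phi> has at least \<open>k\<close> elements, take \<open>C\<close>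
  inside it and containing a value hit twice: the preimage then maps onto \<open>C\<close> but not
  injectively. Otherwise let \<open>C\<close> contain the whole image, so that its preimage is
  everything and \<open>k < n\<close> decides.\<close>

lemma larger_preimage:
  fixes \<phi> :: "nat \<Rightarrow> nat"
  assumes im: "\<phi> ` {..<n} \<subseteq> {..<n}" and ninj: "\<not> inj_on \<phi> {..<n}" and k: "0 < k" "k < n"
  obtains C where "C \<subseteq> {..<n}" "card C = k" "k < card {i\<in>{..<n}. \<phi> i \<in> C}"
proof (cases "k \<le> card (\<phi> ` {..<n})")
  case True
  obtain a b where ab: "a < n" "b < n" "a \<noteq> b" "\<phi> a = \<phi> b"
    using ninj by (auto simp: inj_on_def)
  obtain C where C: "{\<phi> a} \<subseteq> C" "C \<subseteq> \<phi> ` {..<n}" "card C = k"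
    using exists_subset_between[of "{\<phi> a}" k "\<phi> ` {..<n}"] True k ab by auto
  let ?V = "{i\<in>{..<n}. \<phi> i \<in> C}"
  have "\<phi> ` ?V = C"
    using C by auto
  moreover have "\<not> inj_on \<phi> ?V"
    using ab C(1) unfolding inj_on_def by auto
  ultimately have "card C \<noteq> card ?V" "card C \<le> card ?V"
    using eq_card_imp_inj_on[of ?V \<phi>] card_image_le[of ?V \<phi>] by auto
  then show thesis
    using that[of C] C im by fastforce
next
  case False
  obtain C where C: "\<phi> ` {..<n} \<subseteq> C" "C \<subseteq> {..<n}" "card C = k"
    using exists_subset_between[of "\<phi> ` {..<n}" k "{..<n}"] False k im by auto
  have "{i\<in>{..<n}. \<phi> i \<in> C} = {..<n}"
    using C(1) by auto
  then show thesis
    using that[of C] C k by simp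
qed

text \<open>Stabiliser elements can induce any permutation of the indices, so through this lemma
  only the sizes of index sets matter later.\<close>

lemma permutation_into:
  assumes "C \<subseteq> {..<n::nat}" "C' \<subseteq> {..<n}" "card C \<le> card C'"
  obtains \<pi> where "bij_betw \<pi> {..<n} {..<n}" "\<pi> ` C \<subseteq> C'"
proof -
  have fin: "finite C" "finite C'"
    using assms finite_subset by blast+
  obtain E where E: "E \<subseteq> C'" "card E = card C"
    using obtain_subset_with_card_n[OF assms(3)] by metis
  have "finite E"
    using E(1) fin finite_subset by blast
  obtain h where h: "bij_betw h C E"
    using finite_same_card_bij[OF fin(1) \<open>finite E\<close>] E(2) by auto
  have "card ({..<n} - C) = card ({..<n} - E)"
    using assms E fin \<open>finite E\<close> by (simp add: card_Diff_subset order_trans)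
  then obtain k where k: "bij_betw k ({..<n} - C) ({..<n} - E)"
    using finite_same_card_bij[of "{..<n} - C" "{..<n} - E"] by auto
  let ?p = "\<lambda>i. if i \<in> C then h i else k i"
  have "bij_betw ?p C E"
    using h by (rule bij_betw_cong[THEN iffD1, rotated]) auto
  moreover have "bij_betw ?p ({..<n} - C) ({..<n} - E)"
    using k by (rule bij_betw_cong[THEN iffD1, rotated]) auto
  ultimately have "bij_betw ?p (C \<union> ({..<n} - C)) (E \<union> ({..<n} - E))"
    by (rule bij_betw_combine) blast
  then have "bij_betw ?p {..<n} {..<n}"
    using assms(1,2) E(1) by (simp add: Un_absorb1 Un_Diff_cancel)
  moreover have "?p ` C \<subseteq> C'"
    using h E(1) by (auto simp: bij_betw_def)
  ultimately show thesis
    using that by blast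
qed

text \<open>Subrelations are included because \<open>rho\<close> of a product is merely contained in
  the product of the \<open>rho\<close> relations. A proper subrelation of a permutation misses a
  point on each side; a factor that is not a permutation also misses a point on each side, and a
  permutation as the other factor only relabels it.\<close>

lemma sub_comp_dichotomy:
  assumes \<rho>: "\<rho> \<subseteq> N \<times> N" "\<rho> \<in> sym_group N \<or> Domain \<rho> \<noteq> N \<and> Range \<rho> \<noteq> N"
    and \<sigma>: "\<sigma> \<subseteq> N \<times> N" "\<sigma> \<in> sym_group N \<or> Domain \<sigma> \<noteq> N \<and> Range \<sigma> \<noteq> N"
    and \<tau>: "\<tau> \<subseteq> \<rho> O \<sigma>"
  shows "\<tau> \<in> sym_group N \<or> Domain \<tau> \<noteq> N \<and> Range \<tau> \<noteq> N"
proof (cases "\<rho> \<in> sym_group N \<and> \<sigma> \<in> sym_group N")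
  case True
  then have perm: "\<rho> O \<sigma> \<in> sym_group N"
    by (simp add: sym_group_comp)
  then have chart: "\<rho> O \<sigma> \<in> sym_inv_monoid N"
    by (simp add: sym_group_def)
  show ?thesis
  proof (cases "\<tau> = \<rho> O \<sigma>")
    case False
    then obtain i j where ij: "(i, j) \<in> \<rho> O \<sigma>" "(i, j) \<notin> \<tau>"
      using \<tau> by auto
    have "i \<notin> Domain \<tau>" "j \<notin> Range \<tau>"
      using \<tau> ij chart_fun[OF chart] chart_inj[OF chart] by blast+
    then show ?thesis
      using ij(1) chart_dom[OF chart] chart_ran[OF chart] by blast
  qed (use perm in simp)
next
  case False
  have "Domain \<tau> \<noteq> N"
  proof (cases "\<rho> \<in> sym_group N")
    case True
    then obtain k where "k \<in> N" "k \<notin> Domain \<sigma>"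
      using False \<sigma> by blast
    \<comment> \<open>The permutation \<rho> relates \<open>i\<close> to \<open>k\<close> alone,
      where \<sigma> is undefined; so \<open>i\<close> drops out of the domain of \<tau>.\<close>
    moreover obtain i where "(i, k) \<in> \<rho>"
      using True \<open>k \<in> N\<close> unfolding sym_group_def by blast
    moreover have "\<rho> \<in> sym_inv_monoid N"
      using True by (simp add: sym_group_def)
    ultimately have "i \<in> N" "i \<notin> Domain \<tau>"
      using \<tau> \<rho>(1) chart_fun[of \<rho> N] by blast+
    then show ?thesis
      by blast
  qed (use \<rho> \<tau> in blast)
  moreover have "Range \<tau> \<noteq> N"
  proof (cases "\<sigma> \<in> sym_group N")
    case True
    then obtain k where "k \<in> N" "k \<notin> Range \<rho>"
      using False \<rho> by blast
    moreover obtain j where "(k, j) \<in> \<sigma>"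
      using True \<open>k \<in> N\<close> unfolding sym_group_def by blast
    moreover have "\<sigma> \<in> sym_inv_monoid N"
      using True by (simp add: sym_group_def)
    ultimately have "j \<in> N" "j \<notin> Range \<tau>"
      using \<tau> \<sigma>(1) chart_inj[of \<sigma> N] by blast+
    then show ?thesis
      by blast
  qed (use \<sigma> \<tau> in blast)
  ultimately show ?thesis
    by blast
qed

section \<open>The stabiliser of a partition\<close>

text \<open>Largeness of the parts is stated as infinitude, and infinitude of \<open>X\<close>
  becomes a consequence. Since there are at least two parts, each one is a moiety: infinite with
  infinite complement.\<close>

locale moiety_partition =
  fixes X :: "'a set" and n :: nat and P :: "nat \<Rightarrow> 'a set"
  assumes countable_X: "countable X" and two_le: "2 \<le> n" and partition: "is_partition X n P"
    and infinite_part: "i < n \<Longrightarrow> infinite (P i)"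
begin

lemma Union_parts: "(\<Union>i<n. P i) = X"
  using partition by (simp add: is_partition_def)

lemma part_subset: "i < n \<Longrightarrow> P i \<subseteq> X"
  using Union_parts by blast

lemma part_unique: "i < n \<Longrightarrow> j < n \<Longrightarrow> x \<in> P i \<Longrightarrow> x \<in> P j \<Longrightarrow> i = j"
  using partition unfolding is_partition_def disjoint_family_on_def by blast

lemma in_some_part: "x \<in> X \<Longrightarrow> \<exists>i<n. x \<in> P i"
  using Union_parts by blast

lemma countable_part: "i < n \<Longrightarrow> countable (P i)"
  using part_subset countable_X countable_subset by blast

lemma infinite_X: "infinite X"
  using infinite_part[of 0] part_subset[of 0] two_le finite_subset by fastforce

lemma infinite_meets_part:
  assumes "infinite A" "A \<subseteq> X"
  obtains i where "i < n" "infinite (A \<inter> P i)"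
proof -
  have "A = (\<Union>i<n. A \<inter> P i)"
    using assms(2) Union_parts by blast
  then show thesis
    using assms(1) that by (metis finite_UN_I finite_lessThan lessThan_iff)
qed

text \<open>The pieces need only be injective: distinct parts go into distinct parts, which gives
  injectivity overall. Besides permutations this yields the non-surjective total chart of the
  maximality proof.\<close>

lemma piecewise_chart:
  assumes \<pi>: "inj_on \<pi> {..<n}" "\<And>i. i < n \<Longrightarrow> \<pi> i < n"
    and h: "\<And>i. i < n \<Longrightarrow> inj_on (h i) (P i)" "\<And>i. i < n \<Longrightarrow> h i ` P i \<subseteq> P (\<pi> i)"
  obtains s where "s \<in> sym_inv_monoid X" "Domain s = X" "\<And>i. i < n \<Longrightarrow> s `` P i = h i ` P i"
    "\<And>i x. i < n \<Longrightarrow> x \<in> P i \<Longrightarrow> (x, h i x) \<in> s"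
proof -
  define s where "s = {(x, y). \<exists>i<n. x \<in> P i \<and> y = h i x}"
  have h_in: "h i x \<in> P (\<pi> i)" if "i < n" "x \<in> P i" for i x
    using h(2) that by blast
  have img: "s `` P i = h i ` P i" if "i < n" for i
    using that part_unique unfolding s_def by blast
  have sub: "s \<subseteq> X \<times> X"
    using h_in \<pi>(2) part_subset unfolding s_def by blast
  have sv: "single_valued s"
    using part_unique unfolding s_def single_valued_def by blast
  have inj: "single_valued (s\<inverse>)"
  proof (rule single_valuedI)
    fix z x y
    assume "(z, x) \<in> s\<inverse>" "(z, y) \<in> s\<inverse>"
    then obtain i j where ij: "i < n" "x \<in> P i" "z = h i x" "j < n" "y \<in> P j" "z = h j y"
      unfolding s_def by blast
    then have "\<pi> i = \<pi> j"
      using h_in \<pi>(2) part_unique by metis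
    then have "i = j"
      using \<pi>(1) ij by (auto simp: inj_on_def)
    then show "x = y"
      using h(1)[of i] ij by (auto simp: inj_on_def)
  qed
  have "Domain s = X"
    using sub in_some_part unfolding s_def by blast
  moreover have "s \<in> sym_inv_monoid X"
    using sub sv inj by (simp add: sym_inv_monoid_def)
  moreover have "(x, h i x) \<in> s" if "i < n" "x \<in> P i" for i x
    using that unfolding s_def by blast
  ultimately show thesis
    using that[of s] img by simp
qed

lemma stab_of_bijections:
  assumes \<pi>: "bij_betw \<pi> {..<n} {..<n}"
    and h: "\<And>i. i < n \<Longrightarrow> bij_betw (h i) (P i) (P (\<pi> i))"
  obtains s where "s \<in> Stab X n P" "\<And>i x. i < n \<Longrightarrow> x \<in> P i \<Longrightarrow> (x, h i x) \<in> s"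
proof -
  have \<pi>_less: "\<pi> i < n" if "i < n" for i
    using bij_betwE[OF \<pi>] that by blast
  obtain s where s: "s \<in> sym_inv_monoid X" "Domain s = X" "\<And>i. i < n \<Longrightarrow> s `` P i = h i ` P i"
    "\<And>i x. i < n \<Longrightarrow> x \<in> P i \<Longrightarrow> (x, h i x) \<in> s"
  proof (rule piecewise_chart[of \<pi> h])
    show "inj_on \<pi> {..<n}"
      using \<pi> by (simp add: bij_betw_def)
  qed (use \<pi>_less h in \<open>simp_all add: bij_betw_def\<close>)
  have img: "s `` P i = P (\<pi> i)" if "i < n" for i
    using s(3)[OF that] h[OF that] by (simp add: bij_betw_def)
  have "X \<subseteq> Range s"
  proof
    fix y
    assume "y \<in> X"
    then obtain j where "j < n" "y \<in> P j"
      using in_some_part by blast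
    moreover obtain i where "i < n" "j = \<pi> i"
      using bij_betw_imp_surj_on[OF \<pi>] \<open>j < n\<close> by blast
    ultimately have "y \<in> s `` P i"
      using img by simp
    then show "y \<in> Range s"
      by blast
  qed
  then have "s \<in> sym_group X"
    using s(1,2) chart_ran[OF s(1)] by (auto simp: sym_group_def)
  then have "s \<in> Stab X n P"
    using img \<pi>_less unfolding Stab_def by blast
  then show thesis
    by (rule that) (rule s(4))
qed

section \<open>Stabiliser elements with prescribed values or targets\<close>

lemma stab_extending:
  assumes \<pi>: "bij_betw \<pi> {..<n} {..<n}"
    and A: "\<And>i. i < n \<Longrightarrow> A i \<subseteq> P i \<and> infinite (P i - A i)"
    and g: "\<And>i. i < n \<Longrightarrow> inj_on (g i) (A i) \<and> g i ` A i \<subseteq> P (\<pi> i) \<and> infinite (P (\<pi> i) - g i ` A i)"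
  shows "\<exists>s\<in>Stab X n P. \<forall>i<n. \<forall>x\<in>A i. (x, g i x) \<in> s"
proof -
  have "\<exists>h. bij_betw h (P i) (P (\<pi> i)) \<and> (\<forall>x\<in>A i. h x = g i x)" if i: "i < n" for i
  proof -
    have "\<pi> i < n"
      using bij_betwE[OF \<pi>] i by blast
    then obtain h where "bij_betw h (P i) (P (\<pi> i))" "\<And>x. x \<in> A i \<Longrightarrow> h x = g i x"
      using extend_to_bij_betw[of "P i" "P (\<pi> i)" "A i" "g i"] A[OF i] g[OF i] countable_part i
      by metis
    then show ?thesis
      by blast
  qed
  then obtain h where h: "\<And>i. i < n \<Longrightarrow> bij_betw (h i) (P i) (P (\<pi> i))"
    and hg: "\<And>i x. i < n \<Longrightarrow> x \<in> A i \<Longrightarrow> h i x = g i x"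
    by metis
  obtain s where "s \<in> Stab X n P" "\<And>i x. i < n \<Longrightarrow> x \<in> P i \<Longrightarrow> (x, h i x) \<in> s"
    using stab_of_bijections[OF \<pi> h] by metis
  then show ?thesis
    using hg A by (metis subsetD)
qed

text \<open>Only target sets are prescribed here; injections into them are chosen and then handed to
  \<open>stab_extending\<close>.\<close>

lemma stab_moving:
  assumes \<pi>: "bij_betw \<pi> {..<n} {..<n}"
    and A: "\<And>i. i < n \<Longrightarrow> A i \<subseteq> P i \<and> infinite (P i - A i)"
    and B: "\<And>i. i < n \<Longrightarrow> B i \<subseteq> P (\<pi> i) \<and> infinite (B i)"
  shows "\<exists>s\<in>Stab X n P. \<forall>i<n. s `` A i \<subseteq> B i"
proof -
  have "\<exists>g. inj_on g (A i) \<and> g ` A i \<subseteq> B i \<and> infinite (P (\<pi> i) - g ` A i)" if i: "i < n" for i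
  proof -
    \<comment> \<open>Only the half \<open>C\<close> of the target receives points, so the other
      half keeps the complement of the image infinite.\<close>
    obtain C where C: "C \<subseteq> B i" "infinite C" "infinite (B i - C)"
      using infinite_split[of "B i"] B[OF i] by metis
    obtain g where g: "inj_on g (A i)" "g ` A i \<subseteq> C"
      using countable_infinite_inj_into[OF countable_subset[OF _ countable_part[OF i]] C(2)] A[OF i]
      by metis
    have "B i - C \<subseteq> P (\<pi> i) - g ` A i"
      using g(2) B[OF i] by blast
    then have "infinite (P (\<pi> i) - g ` A i)"
      using C(3) finite_subset by blast
    then show ?thesis
      using g C(1) by blast
  qed
  then obtain g where g: "\<And>i. i < n \<Longrightarrow> inj_on (g i) (A i)" "\<And>i. i < n \<Longrightarrow> g i ` A i \<subseteq> B i"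
    "\<And>i. i < n \<Longrightarrow> infinite (P (\<pi> i) - g i ` A i)"
    by metis
  have "g i ` A i \<subseteq> P (\<pi> i)" if "i < n" for i
    using g(2)[OF that] B[OF that] by blast
  then have "\<exists>s\<in>Stab X n P. \<forall>i<n. \<forall>x\<in>A i. (x, g i x) \<in> s"
    using g A by (intro stab_extending[OF \<pi>]) simp_all
  then obtain s where s: "s \<in> Stab X n P" "\<And>i x. i < n \<Longrightarrow> x \<in> A i \<Longrightarrow> (x, g i x) \<in> s"
    by blast
  have "s \<in> sym_inv_monoid X"
    using s(1) by (simp add: Stab_def sym_group_def)
  then have "s `` A i \<subseteq> g i ` A i" if "i < n" for i
    using s(2)[OF that] chart_fun by fast
  then show ?thesis
    using s(1) g(2) by (meson order_trans)
qed

lemma stab_moving_one: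
  assumes "j < n" "k < n" "A \<subseteq> P j" "infinite (P j - A)" "B \<subseteq> P k" "infinite B"
  obtains s where "s \<in> Stab X n P" "s `` A \<subseteq> B"
proof -
  obtain \<pi> where \<pi>: "bij_betw \<pi> {..<n} {..<n}" "\<pi> ` {j} \<subseteq> {k}"
    using permutation_into[of "{j}" n "{k}"] assms by auto
  have \<pi>_less: "\<pi> i < n" if "i < n" for i
    using bij_betwE[OF \<pi>(1)] that by blast
  \<comment> \<open>At all other indices the source is empty, so nothing is prescribed
    there.\<close>
  have "\<exists>s\<in>Stab X n P. \<forall>i<n. s `` (if i = j then A else {}) \<subseteq> (if i = j then B else P (\<pi> i))"
    by (rule stab_moving[OF \<pi>(1), of "\<lambda>i. if i = j then A else {}"
          "\<lambda>i. if i = j then B else P (\<pi> i)"])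
      (use assms \<pi>(2) \<pi>_less infinite_part in auto)
  then show thesis
    using that assms(1) by fastforce
qed

lemma stab_extending_one:
  assumes "j < n" "A \<subseteq> P j" "inj_on g A" "g ` A \<subseteq> P j" "infinite (P j - A)" "infinite (P j - g ` A)"
  obtains s where "s \<in> Stab X n P" "\<And>x. x \<in> A \<Longrightarrow> (x, g x) \<in> s"
proof -
  have "\<exists>s\<in>Stab X n P. \<forall>i<n. \<forall>x\<in>(if i = j then A else {}). (x, g x) \<in> s"
    by (rule stab_extending[of id "\<lambda>i. if i = j then A else {}" "\<lambda>_. g"])
      (use assms infinite_part in auto)
  then show thesis
    using that assms(1) by auto
qed

lemma stab_moving_point:
  assumes "x \<in> X" "y \<in> X"
  obtains s where "s \<in> Stab X n P" "(x, y) \<in> s"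
proof -
  obtain j k where jk: "j < n" "x \<in> P j" "k < n" "y \<in> P k"
    using in_some_part[OF assms(1)] in_some_part[OF assms(2)] by blast
  obtain \<pi> where \<pi>: "bij_betw \<pi> {..<n} {..<n}" "\<pi> ` {j} \<subseteq> {k}"
    using permutation_into[of "{j}" n "{k}"] jk by auto
  have \<pi>_less: "\<pi> i < n" if "i < n" for i
    using bij_betwE[OF \<pi>(1)] that by blast
  have "\<exists>s\<in>Stab X n P. \<forall>i<n. \<forall>z\<in>(if i = j then {x} else {}). (z, y) \<in> s"
    by (rule stab_extending[OF \<pi>(1), of "\<lambda>i. if i = j then {x} else {}" "\<lambda>_ _. y"])
      (use jk \<pi>(2) \<pi>_less infinite_part in auto)
  then show thesis
    using that jk by auto
qed

end

section \<open>The semigroup of the theorem\<close>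

context moiety_partition
begin

lemma rho_iff:
  assumes "f \<in> sym_inv_monoid X"
  shows "(i, j) \<in> rho X n P f \<longleftrightarrow> i < n \<and> j < n \<and> infinite (f `` P i \<inter> P j)"
proof -
  have "f `` P i \<inter> P j \<subseteq> X"
    using chart_ran[OF assms] by blast
  then show ?thesis
    using eqpoll_countable_iff[OF countable_X infinite_X] by (simp add: rho_def)
qed

lemma rho_subset: "rho X n P f \<subseteq> {..<n} \<times> {..<n}"
  by (auto simp: rho_def)

lemma rho_converse:
  assumes "f \<in> sym_inv_monoid X"
  shows "rho X n P (f\<inverse>) = (rho X n P f)\<inverse>"
  using rho_iff[OF assms] rho_iff[OF chart_converse[OF assms]] infinite_chart_Image_Int[OF assms]
  by (auto simp: Int_commute)

text \<open>Infinitely many points pass from part \<open>i\<close> to part \<open>j\<close>, and by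
  the pigeonhole principle infinitely many of them pass through the same intermediate part
  \<open>k\<close>. The reverse inclusion can fail: the points of \<open>P k\<close> reached by
  \<open>f\<close> may lie outside the domain of \<open>g\<close>.\<close>

lemma rho_comp_subset:
  assumes f: "f \<in> sym_inv_monoid X" and g: "g \<in> sym_inv_monoid X"
  shows "rho X n P (f O g) \<subseteq> rho X n P f O rho X n P g"
proof (rule subrelI)
  fix i j
  assume "(i, j) \<in> rho X n P (f O g)"
  then have ij: "i < n" "j < n" "infinite (g `` f `` P i \<inter> P j)"
    using rho_iff[OF chart_comp[OF f g]] by (auto simp: relcomp_Image)
  then have "infinite (f `` P i \<inter> g\<inverse> `` P j)"
    using infinite_chart_Image_Int[OF g] by blast
  moreover have "f `` P i \<inter> g\<inverse> `` P j \<subseteq> X"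
    using chart_ran[OF f] by blast
  ultimately obtain k where k: "k < n" "infinite (f `` P i \<inter> g\<inverse> `` P j \<inter> P k)"
    using infinite_meets_part by metis
  have "infinite (f `` P i \<inter> P k)" "infinite (P k \<inter> g\<inverse> `` P j)"
    using k(2) by (auto elim!: contrapos_nn intro: finite_subset[rotated])
  then show "(i, j) \<in> rho X n P f O rho X n P g"
    using ij k(1) rho_iff[OF f] rho_iff[OF g] infinite_chart_Image_Int[OF g] by blast
qed

lemma A_part_iff:
  "f \<in> A_part X n P \<longleftrightarrow> f \<in> sym_inv_monoid X \<and> (rho X n P f \<in> sym_group {..<n} \<or>
     Domain (rho X n P f) \<noteq> {..<n} \<and> Range (rho X n P f) \<noteq> {..<n})"
  by (simp add: A_part_def)

section \<open>Closure of \<open>A_part\<close> and its position relative to the two groups\<close>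

lemma A_part_inverse_subsemigroup: "inverse_subsemigroup X (A_part X n P)"
  unfolding inverse_subsemigroup_def
proof (intro conjI ballI)
  fix f g
  assume "f \<in> A_part X n P" "g \<in> A_part X n P"
  then show "f O g \<in> A_part X n P"
    unfolding A_part_iff using chart_comp
      sub_comp_dichotomy[OF rho_subset _ rho_subset _ rho_comp_subset] by metis
next
  fix f
  assume f: "f \<in> A_part X n P"
  then have "rho X n P (f\<inverse>) = (rho X n P f)\<inverse>"
    using rho_converse A_part_iff by blast
  then show "f\<inverse> \<in> A_part X n P"
    using f chart_converse[of f X] sym_group_converse[of "rho X n P f" "{..<n}"]
    unfolding A_part_iff by auto
qed (auto simp: A_part_def)

text \<open>For a stabiliser element, \<open>rho\<close> is the graph of the permutation that it
  induces on the parts. Two parts with the same image would share points, as the element is total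
  and injective.\<close>

lemma Stab_subset_A_part: "Stab X n P \<subseteq> A_part X n P"
proof
  fix s
  assume s: "s \<in> Stab X n P"
  then have chart: "s \<in> sym_inv_monoid X" and dom: "Domain s = X"
    by (auto simp: Stab_def sym_group_def)
  have "\<forall>i<n. \<exists>j<n. s `` P i = P j"
    using s by (simp add: Stab_def)
  then obtain \<pi> where \<pi>: "\<And>i. i < n \<Longrightarrow> \<pi> i < n" "\<And>i. i < n \<Longrightarrow> s `` P i = P (\<pi> i)"
    by metis
  have "(i, j) \<in> rho X n P s \<longleftrightarrow> i < n \<and> j = \<pi> i" for i j
  proof -
    have "P (\<pi> i) \<inter> P j = (if j = \<pi> i then P j else {})" if "i < n" "j < n"
      using part_unique[of "\<pi> i" j] \<pi>(1) that by auto
    then show ?thesis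
      using rho_iff[OF chart] \<pi> infinite_part by (auto split: if_splits)
  qed
  then have "rho X n P s = (\<lambda>i. (i, \<pi> i)) ` {..<n}"
    by auto
  moreover have "bij_betw \<pi> {..<n} {..<n}"
  proof -
    have "inj_on \<pi> {..<n}"
    proof (rule inj_onI)
      fix i j
      assume ij: "i \<in> {..<n}" "j \<in> {..<n}" "\<pi> i = \<pi> j"
      obtain x where "x \<in> P i"
        using infinite_part[of i] ij(1) by fastforce
      then obtain y where "(x, y) \<in> s"
        using dom part_subset ij(1) by blast
      then have "y \<in> s `` P j"
        using \<open>x \<in> P i\<close> ij \<pi>(2)[of i] \<pi>(2)[of j] by auto
      then have "x \<in> P j"
        using chart_inj[OF chart] \<open>(x, y) \<in> s\<close> by blast
      then show "i = j"
        using part_unique \<open>x \<in> P i\<close> ij by blast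
    qed
    moreover have "\<pi> ` {..<n} \<subseteq> {..<n}"
      using \<pi>(1) by blast
    ultimately show ?thesis
      by (simp add: bij_betw_def endo_inj_surj)
  qed
  ultimately show "s \<in> A_part X n P"
    using chart sym_group_graph by (metis A_part_iff)
qed

text \<open>A permutation that keeps one half of \<open>P 0\<close> in place and sends the other
  half into \<open>P 1\<close> has a total \<open>rho\<close> relating 0 to both 0 and 1.\<close>

lemma sym_group_not_subset_A_part: "\<not> sym_group X \<subseteq> A_part X n P"
proof
  assume sub: "sym_group X \<subseteq> A_part X n P"
  have n: "0 < n" "1 < n" "(0::nat) \<noteq> 1"
    using two_le by auto
  obtain A where A: "A \<subseteq> P 0" "infinite A" "infinite (P 0 - A)"
    using infinite_split infinite_part n(1) by metis
  obtain h where h: "inj_on h (P 0 - A)" "h ` (P 0 - A) \<subseteq> P 1"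
    using countable_infinite_inj_into[of "P 0 - A" "P 1"] countable_part infinite_part n
    by (metis countable_Diff)
  \<comment> \<open>\<open>?g\<close> is injective on \<open>P 0\<close>, and its image omits the
    infinite set \<open>P 0 - A\<close>; hence it extends to a permutation of
    \<open>X\<close>.\<close>
  let ?g = "\<lambda>x. if x \<in> A then x else h x"
  have disj: "P 0 \<inter> P 1 = {}"
    using part_unique n by blast
  have "h x \<notin> A" if "x \<in> P 0 - A" for x
    using h(2) A(1) disj that by blast
  then have g_inj: "inj_on ?g (P 0)"
    using h(1) unfolding inj_on_def by (metis DiffI)
  have g_im: "?g ` P 0 \<subseteq> X"
    using h(2) A(1) part_subset[OF n(1)] part_subset[OF n(2)] by auto
  have inf_dom: "infinite (X - P 0)"
  proof -
    have "P 1 \<subseteq> X - P 0"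
      using part_subset[OF n(2)] disj by blast
    then show ?thesis
      using infinite_part[OF n(2)] finite_subset by blast
  qed
  have "P 0 - A \<subseteq> X - ?g ` P 0"
    using part_subset[OF n(1)] h(2) disj by auto
  then have inf_im: "infinite (X - ?g ` P 0)"
    using A(3) finite_subset by blast
  obtain k where k: "bij_betw k X X" "\<And>x. x \<in> P 0 \<Longrightarrow> k x = ?g x"
    using extend_to_bij_betw[OF countable_X countable_X part_subset[OF n(1)] g_inj g_im inf_dom inf_im]
    by blast
  define \<sigma> where "\<sigma> = (\<lambda>x. (x, k x)) ` X"
  have \<sigma>: "\<sigma> \<in> sym_group X"
    unfolding \<sigma>_def by (rule sym_group_graph[OF k(1)])
  then have chart: "\<sigma> \<in> sym_inv_monoid X" and dom: "Domain \<sigma> = X"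
    by (auto simp: sym_group_def)
  \<comment> \<open>\<sigma> is total, so each part has an infinite image, which meets some part
    infinitely often.\<close>
  have total: "Domain (rho X n P \<sigma>) = {..<n}"
  proof
    show "{..<n} \<subseteq> Domain (rho X n P \<sigma>)"
    proof
      fix i
      assume i: "i \<in> {..<n}"
      then have "infinite (\<sigma> `` P i)"
        using infinite_chart_Image[OF chart infinite_part] part_subset dom by blast
      moreover have "\<sigma> `` P i \<subseteq> X"
        using chart_ran[OF chart] by blast
      ultimately obtain j where "j < n" "infinite (\<sigma> `` P i \<inter> P j)"
        using infinite_meets_part by metis
      then show "i \<in> Domain (rho X n P \<sigma>)"
        using i rho_iff[OF chart] by blast
    qed
  qed (use rho_subset in blast)
  have "A \<subseteq> \<sigma> `` P 0 \<inter> P 0"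
    using A(1) k(2) part_subset[OF n(1)] unfolding \<sigma>_def by (force simp: image_iff)
  then have 0: "(0, 0) \<in> rho X n P \<sigma>"
    using rho_iff[OF chart] n(1) A(2) finite_subset by blast
  have "h ` (P 0 - A) \<subseteq> \<sigma> `` P 0 \<inter> P 1"
    using h(2) k(2) part_subset[OF n(1)] unfolding \<sigma>_def by (force simp: image_iff)
  moreover have "infinite (h ` (P 0 - A))"
    using A(3) h(1) finite_imageD by blast
  ultimately have 1: "(0, 1) \<in> rho X n P \<sigma>"
    using rho_iff[OF chart] n finite_subset by blast
  have "rho X n P \<sigma> \<notin> sym_group {..<n}"
    using chart_fun[of "rho X n P \<sigma>", OF _ 0 1] n(3) by (auto simp: sym_group_def)
  moreover have "\<sigma> \<in> A_part X n P"
    using sub \<sigma> by blast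
  ultimately show False
    using total by (simp add: A_part_iff)
qed

end

section \<open>Domains that can be moved into one part\<close>

locale stab_semigroup = moiety_partition +
  fixes M :: "'a rel set"
  assumes subsemigroup: "inverse_subsemigroup X M" and stab: "Stab X n P \<subseteq> M"
begin

text \<open>The choice of \<open>P 0\<close> is immaterial, since the stabiliser carries any part
  onto any other.\<close>

definition absorbed :: "'a set \<Rightarrow> bool" where
  "absorbed D \<longleftrightarrow> (\<exists>f\<in>M. D \<subseteq> Domain f \<and> f `` D \<subseteq> P 0 \<and> infinite (P 0 - f `` D))"

lemmas M_chart = inverse_subsemigroupD(1)[OF subsemigroup]
  and M_comp = inverse_subsemigroupD(2)[OF subsemigroup]
  and M_converse = inverse_subsemigroupD(3)[OF subsemigroup]

lemma stab_in_M: "s \<in> Stab X n P \<Longrightarrow> s \<in> M"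
  using stab by blast

lemma stab_Domain: "s \<in> Stab X n P \<Longrightarrow> Domain s = X"
  by (simp add: Stab_def sym_group_def)

text \<open>Compose \<open>m\<close> with a witness for \<open>D'\<close>. Apart from the initial
  \<open>absorbed_half_part\<close>, every absorbed set below is obtained by this step.\<close>

lemma absorbed_pullback:
  assumes m: "m \<in> M" "D \<subseteq> Domain m" "m `` D \<subseteq> D'" and D': "absorbed D'"
  shows "absorbed D"
proof -
  obtain f where f: "f \<in> M" "D' \<subseteq> Domain f" "f `` D' \<subseteq> P 0" "infinite (P 0 - f `` D')"
    using D' by (auto simp: absorbed_def)
  have img: "(m O f) `` D \<subseteq> f `` D'"
    using m(3) by blast
  then have "infinite (P 0 - (m O f) `` D)"
    using f(4) finite_subset[of "P 0 - f `` D'" "P 0 - (m O f) `` D"] by blast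
  moreover have "D \<subseteq> Domain (m O f)"
    using m(2,3) f(2) by blast
  ultimately show ?thesis
    using M_comp[OF m(1) f(1)] img f(3) unfolding absorbed_def by blast
qed

text \<open>Over a permutation of indices taking \<open>C\<close> into \<open>C'\<close>, a
  stabiliser element squeezes each coinfinite piece of \<open>D\<close> into an infinite set
  \<open>H \<inter> P (\<pi> i)\<close>. So for sets coinfinite in every part, only the number of
  parts they occupy counts.\<close>

lemma absorbed_spread:
  assumes H: "absorbed H" "C' \<subseteq> {..<n}" "\<And>i. i \<in> C' \<Longrightarrow> infinite (H \<inter> P i)"
    and C: "C \<subseteq> {..<n}" "card C \<le> card C'"
    and D: "D \<subseteq> (\<Union>i\<in>C. P i)" "\<And>i. i < n \<Longrightarrow> infinite (P i - D)"
  shows "absorbed D"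
proof -
  obtain \<pi> where \<pi>: "bij_betw \<pi> {..<n} {..<n}" "\<pi> ` C \<subseteq> C'"
    using permutation_into[OF C(1) H(2) C(2)] by blast
  have \<pi>_less: "\<pi> i < n" if "i < n" for i
    using bij_betwE[OF \<pi>(1)] that by blast
  \<comment> \<open>Outside \<open>C\<close> the pieces of \<open>D\<close> are empty, and any
    infinite target will do.\<close>
  have "\<exists>s\<in>Stab X n P. \<forall>i<n. s `` (D \<inter> P i) \<subseteq> (if i \<in> C then H \<inter> P (\<pi> i) else P (\<pi> i))"
  proof (rule stab_moving[OF \<pi>(1)])
    show "D \<inter> P i \<subseteq> P i \<and> infinite (P i - D \<inter> P i)" if "i < n" for i
      using D(2)[OF that] by (simp add: Diff_Int)
    show "(if i \<in> C then H \<inter> P (\<pi> i) else P (\<pi> i)) \<subseteq> P (\<pi> i) \<and>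
        infinite (if i \<in> C then H \<inter> P (\<pi> i) else P (\<pi> i))" if "i < n" for i
      using H(3) \<pi>(2) \<pi>_less infinite_part that by auto
  qed
  then obtain s where s: "s \<in> Stab X n P" "\<And>i. i \<in> C \<Longrightarrow> s `` (D \<inter> P i) \<subseteq> H"
    using C(1) by fastforce
  have "s `` D \<subseteq> H"
    using D(1) s(2) by blast
  moreover have "D \<subseteq> Domain s"
    using D(1) C(1) part_subset stab_Domain[OF s(1)] by blast
  ultimately show ?thesis
    using absorbed_pullback[OF stab_in_M[OF s(1)] _ _ H(1)] by blast
qed

lemma absorbed_half_part:
  obtains H where "absorbed H" "infinite (H \<inter> P 0)"
proof -
  have 0: "0 < n"
    using two_le by simp
  obtain A where A: "A \<subseteq> P 0" "infinite A" "infinite (P 0 - A)"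
    using infinite_split infinite_part[OF 0] by metis
  obtain s where s: "s \<in> Stab X n P" "s `` A \<subseteq> A"
    using stab_moving_one[OF 0 0 A(1,3,1,2)] by metis
  have "P 0 - A \<subseteq> P 0 - s `` A"
    using s(2) by blast
  then have "infinite (P 0 - s `` A)"
    using A(3) finite_subset by blast
  moreover have "A \<subseteq> Domain s"
    using A(1) part_subset[OF 0] stab_Domain[OF s(1)] by blast
  ultimately have "absorbed A"
    unfolding absorbed_def using A(1) s(2) stab_in_M[OF s(1)] by blast
  moreover have "A \<inter> P 0 = A"
    using A(1) by blast
  ultimately show thesis
    using that[of A] A(2) by simp
qed

text \<open>Pulling back along \<open>f\<close> a set absorbed over \<open>C\<close> gives one absorbed over the larger
  \<open>\<phi> -` C\<close>; the stabiliser then replaces \<open>\<phi> -` C\<close> by any set of indices of the same size.\<close>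

lemma absorbed_over_more_parts:
  assumes f: "f \<in> M" and \<phi>: "\<And>i. i < n \<Longrightarrow> (i, \<phi> i) \<in> rho X n P f" "\<not> inj_on \<phi> {..<n}"
    and k: "1 \<le> k" "k \<le> n"
  shows "\<exists>H C. absorbed H \<and> C \<subseteq> {..<n} \<and> k \<le> card C \<and> (\<forall>i\<in>C. infinite (H \<inter> P i))"
  using k
proof (induction k rule: nat_induct_at_least)
  case base
  obtain H where "absorbed H" "infinite (H \<inter> P 0)"
    using absorbed_half_part .
  then show ?case
    using two_le by (intro exI[of _ H] exI[of _ "{0}"]) auto
next
  case (Suc k)
  then obtain H' C' where IH: "absorbed H'" "C' \<subseteq> {..<n}" "k \<le> card C'"
    "\<And>i. i \<in> C' \<Longrightarrow> infinite (H' \<inter> P i)"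
    by auto
  have chart: "f \<in> sym_inv_monoid X"
    using f by (rule M_chart)
  have "\<phi> ` {..<n} \<subseteq> {..<n}"
    using \<phi>(1) rho_subset by blast
  then obtain C where C: "C \<subseteq> {..<n}" "card C = k" "k < card {i\<in>{..<n}. \<phi> i \<in> C}"
    using larger_preimage[of \<phi> n k] \<phi>(2) Suc by auto
  define V where "V = {i\<in>{..<n}. \<phi> i \<in> C}"
  define W where "W i = P i \<inter> f\<inverse> `` P (\<phi> i)" for i
  have "infinite (W i)" if "i < n" for i
    using \<phi>(1)[OF that] rho_iff[OF chart] infinite_chart_Image_Int[OF chart] unfolding W_def by blast
  \<comment> \<open>\<open>W i\<close> holds the points of \<open>P i\<close> that \<open>f\<close>
    sends into \<open>P (\<phi> i)\<close>. Only half of it goes into \<open>H\<close>; the image of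
    the other half keeps the image of \<open>H\<close> coinfinite in that part.\<close>
  then have "\<forall>i<n. \<exists>K\<subseteq>W i. infinite K \<and> infinite (W i - K)"
    using infinite_split by metis
  then obtain K where K: "\<And>i. i < n \<Longrightarrow> K i \<subseteq> W i" "\<And>i. i < n \<Longrightarrow> infinite (K i)"
    "\<And>i. i < n \<Longrightarrow> infinite (W i - K i)"
    by metis
  define H where "H = (\<Union>i\<in>V. K i)"
  have fW: "f `` W i \<subseteq> P (\<phi> i)" for i
    using chart_fun[OF chart] unfolding W_def by blast
  \<comment> \<open>The image of \<open>H\<close> lies over \<open>C\<close>, which has only
    \<open>k\<close> indices, so the induction hypothesis reaches it, while \<open>H\<close> itself
    lies over the larger set \<open>V\<close>.\<close>
  have "absorbed (f `` H)"
  proof (rule absorbed_spread[OF IH(1,2,4) C(1)])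
    show "card C \<le> card C'"
      using IH(3) C(2) by simp
    show "f `` H \<subseteq> (\<Union>i\<in>C. P i)"
      using K(1) fW unfolding H_def V_def by blast
    show "infinite (P j - f `` H)" if j: "j < n" for j
    proof (cases "\<exists>i\<in>V. \<phi> i = j")
      case True
      then obtain i where i: "i < n" "\<phi> i = j"
        by (auto simp: V_def)
      have rest: "f `` (W i - K i) \<subseteq> P j - f `` H"
      proof
        fix y
        assume "y \<in> f `` (W i - K i)"
        then obtain x where x: "(x, y) \<in> f" "x \<in> W i" "x \<notin> K i"
          by blast
        have "x \<notin> H"
        proof
          assume "x \<in> H"
          then obtain i' where i': "i' < n" "x \<in> K i'"
            by (auto simp: H_def V_def)
          then have "i' = i"
            using K(1) x(2) i(1) part_unique unfolding W_def by blast
          then show False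
            using i'(2) x(3) by blast
        qed
        then have "y \<notin> f `` H"
          using x(1) chart_inj[OF chart] by blast
        then show "y \<in> P j - f `` H"
          using x fW i(2) by blast
      qed
      have "infinite (f `` (W i - K i))"
        by (rule infinite_chart_Image[OF chart K(3)[OF i(1)]]) (auto simp: W_def)
      then show ?thesis
        using rest finite_subset by blast
    next
      case False
      have "P j \<inter> f `` H = {}"
      proof (rule ccontr)
        assume "P j \<inter> f `` H \<noteq> {}"
        then obtain i y where "i \<in> V" "y \<in> f `` K i" "y \<in> P j"
          unfolding H_def by blast
        then show False
          using False fW K(1) part_unique[of j "\<phi> i" y] j C(1) unfolding V_def by blast
      qed
      then have "P j - f `` H = P j"
        by blast
      then show ?thesis
        using infinite_part[OF j] by simp
    qed
  qed
  moreover have "H \<subseteq> Domain f"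
    using K(1) unfolding H_def V_def W_def by blast
  ultimately have "absorbed H"
    using absorbed_pullback[OF f] by blast
  moreover have "infinite (H \<inter> P i)" if "i \<in> V" for i
  proof -
    have "K i \<subseteq> H \<inter> P i" "infinite (K i)"
      using that K(1,2) unfolding H_def W_def V_def by blast+
    then show ?thesis
      using finite_subset by blast
  qed
  ultimately show ?case
    using C(3) by (intro exI[of _ H] exI[of _ V]) (auto simp: V_def)
qed

lemma coinfinite_absorbed:
  assumes f: "f \<in> M" "f \<notin> A_part X n P"
    and D: "D \<subseteq> X" "\<And>i. i < n \<Longrightarrow> infinite (P i - D)"
  shows "absorbed D"
proof -
  \<comment> \<open>Outside \<open>A_part\<close>, \<open>rho\<close> is not a permutation but is
    full on at least one side; inverting \<open>f\<close> if necessary makes that side the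
    domain.\<close>
  have "\<exists>g\<in>M. Domain (rho X n P g) = {..<n} \<and> rho X n P g \<notin> sym_group {..<n}"
  proof (cases "Domain (rho X n P f) = {..<n}")
    case True
    then show ?thesis
      using f M_chart[OF f(1)] A_part_iff by blast
  next
    case False
    then have "Range (rho X n P f) = {..<n}" "rho X n P f \<notin> sym_group {..<n}"
      using f M_chart[OF f(1)] A_part_iff by blast+
    then have "Domain (rho X n P (f\<inverse>)) = {..<n}" "rho X n P (f\<inverse>) \<notin> sym_group {..<n}"
      using rho_converse[OF M_chart[OF f(1)]] sym_group_converse[of "rho X n P (f\<inverse>)" "{..<n}"]
      by auto
    then show ?thesis
      using M_converse[OF f(1)] by blast
  qed
  then obtain g where g: "g \<in> M" "Domain (rho X n P g) = {..<n}" "rho X n P g \<notin> sym_group {..<n}"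
    by blast
  obtain \<phi> where \<phi>: "\<And>i. i < n \<Longrightarrow> (i, \<phi> i) \<in> rho X n P g" "\<not> inj_on \<phi> {..<n}"
    using noninjective_selection[OF rho_subset g(2,3)] by blast
  obtain H C where H: "absorbed H" "C \<subseteq> {..<n}" "n \<le> card C" "\<And>i. i \<in> C \<Longrightarrow> infinite (H \<inter> P i)"
    using absorbed_over_more_parts[OF g(1) \<phi>, of n] two_le by auto
  show ?thesis
    \<comment> \<open>\<open>C\<close> has at least \<open>n\<close> elements, so every index set is
      small enough to be spread into it.\<close>
    by (rule absorbed_spread[OF H(1,2,4), of "{..<n}"]) (use H(3) D Union_parts in auto)
qed

text \<open>Conjugation by \<open>t\<close> turns \<sigma> into a permutation \<tau> of a coinfinite
  subset of \<open>P 0\<close>. This extends to a stabiliser element \<open>s\<close>, and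
  conjugating \<open>s\<close> back recovers \<sigma>.\<close>

lemma absorbed_X_imp_sym_group:
  assumes "absorbed X"
  shows "sym_group X \<subseteq> M"
proof
  fix \<sigma>
  assume \<sigma>: "\<sigma> \<in> sym_group X"
  obtain t where t: "t \<in> M" "X \<subseteq> Domain t" "t `` X \<subseteq> P 0" "infinite (P 0 - t `` X)"
    using assms by (auto simp: absorbed_def)
  have t_chart: "t \<in> sym_inv_monoid X" and \<sigma>_chart: "\<sigma> \<in> sym_inv_monoid X"
    using t(1) M_chart \<sigma> by (auto simp: sym_group_def)
  define \<tau> where "\<tau> = t\<inverse> O \<sigma> O t"
  have \<tau>_chart: "\<tau> \<in> sym_inv_monoid X"
    unfolding \<tau>_def using chart_comp chart_converse t_chart \<sigma>_chart by blast
  have range: "Range \<sigma> = X" and dom: "Domain \<sigma> = X"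
    using \<sigma> by (auto simp: sym_group_def)
  have Dom_\<tau>: "Domain \<tau> = t `` X"
    using t(2) dom chart_ran[OF \<sigma>_chart] chart_dom[OF t_chart] unfolding \<tau>_def by blast
  have Ran_\<tau>: "Range \<tau> = t `` X"
    using t(2) range chart_dom[OF \<sigma>_chart] chart_dom[OF t_chart] unfolding \<tau>_def by blast
  obtain g where g: "\<And>x. x \<in> Domain \<tau> \<Longrightarrow> (x, g x) \<in> \<tau>" "inj_on g (Domain \<tau>)"
    "g ` Domain \<tau> = Range \<tau>"
    using chart_function[OF \<tau>_chart] by blast
  obtain s where s: "s \<in> Stab X n P" "\<And>x. x \<in> t `` X \<Longrightarrow> (x, g x) \<in> s"
    using stab_extending_one[of 0 "t `` X" g] g(2,3) t(3,4) two_le by (auto simp: Dom_\<tau> Ran_\<tau>)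
  have sub: "\<sigma> \<subseteq> t O s O t\<inverse>"
  proof (rule subrelI)
    fix x y
    assume xy: "(x, y) \<in> \<sigma>"
    obtain x' y' where t': "(x, x') \<in> t" "(y, y') \<in> t"
      using t(2) chart_dom[OF \<sigma>_chart xy] chart_ran[OF \<sigma>_chart xy] by blast
    then have "(x', y') \<in> \<tau>"
      using xy unfolding \<tau>_def by blast
    then have "g x' = y'"
      using g(1) chart_fun[OF \<tau>_chart] by blast
    then have "(x', y') \<in> s"
      using s(2) t'(1) chart_dom[OF t_chart t'(1)] by blast
    then show "(x, y) \<in> t O s O t\<inverse>"
      using t' by blast
  qed
  have mem: "t O s O t\<inverse> \<in> M"
    by (rule M_comp[OF t(1) M_comp[OF stab_in_M[OF s(1)] M_converse[OF t(1)]]])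
  \<comment> \<open>A chart that contains the total chart \<sigma> has no room for further
    pairs.\<close>
  have "t O s O t\<inverse> \<subseteq> \<sigma>"
  proof (rule subrelI)
    fix x y
    assume xy: "(x, y) \<in> t O s O t\<inverse>"
    then obtain z where z: "(x, z) \<in> \<sigma>"
      using dom chart_dom[OF t_chart] by blast
    then have "z = y"
      using sub xy chart_fun[OF M_chart[OF mem]] by blast
    then show "(x, y) \<in> \<sigma>"
      using z by simp
  qed
  then have "t O s O t\<inverse> = \<sigma>"
    using sub by (rule subset_antisym)
  then show "\<sigma> \<in> M"
    using mem by (rule subst)
qed

end

section \<open>Maximality\<close>

lemma (in moiety_partition) A_part_maximal: "maximal_inverse_subsemigroup X (A_part X n P)"
  unfolding maximal_inverse_subsemigroup_def
proof (intro conjI allI impI)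
  show "inverse_subsemigroup X (A_part X n P)"
    by (rule A_part_inverse_subsemigroup)
  show "A_part X n P \<noteq> sym_inv_monoid X"
    using sym_group_not_subset_A_part by (auto simp: sym_group_def)
  fix N
  assume N: "inverse_subsemigroup X N \<and> N \<noteq> sym_inv_monoid X \<and> A_part X n P \<subseteq> N"
  interpret N: stab_semigroup X n P N
    by standard (use N Stab_subset_A_part in auto)
  show "N = A_part X n P"
  proof (rule ccontr)
    assume "N \<noteq> A_part X n P"
    then obtain f where f: "f \<in> N" "f \<notin> A_part X n P"
      using N by blast
    \<comment> \<open>Mapping each part injectively onto an infinite, coinfinite subset of itself
      keeps \<open>rho\<close> the identity, so the glued chart \<open>u\<close> lies in
      \<open>A_part\<close> although it misses infinitely many points of every part.\<close>
    have "\<exists>h. inj_on h (P i) \<and> h ` P i \<subseteq> P i \<and> infinite (h ` P i) \<and> infinite (P i - h ` P i)"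
      if i: "i < n" for i
    proof -
      obtain B where B: "B \<subseteq> P i" "infinite B" "infinite (P i - B)"
        using infinite_split infinite_part[OF i] by metis
      obtain h where h: "bij_betw h (P i) B"
        using countable_infinite_bij_betw[OF countable_part[OF i] infinite_part[OF i]
            countable_subset[OF B(1) countable_part[OF i]] B(2)] by blast
      then show ?thesis
        using B by (auto simp: bij_betw_def)
    qed
    then obtain h where h: "\<And>i. i < n \<Longrightarrow> inj_on (h i) (P i)" "\<And>i. i < n \<Longrightarrow> h i ` P i \<subseteq> P i"
      "\<And>i. i < n \<Longrightarrow> infinite (h i ` P i)" "\<And>i. i < n \<Longrightarrow> infinite (P i - h i ` P i)"
      by metis
    obtain u where u: "u \<in> sym_inv_monoid X" "Domain u = X" "\<And>i. i < n \<Longrightarrow> u `` P i = h i ` P i"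
    proof (rule piecewise_chart[of id h])
    qed (use h(1,2) in simp_all)
    have "rho X n P u = (\<lambda>i. (i, id i)) ` {..<n}"
    proof -
      have "h i ` P i \<inter> P j = (if i = j then h i ` P i else {})" if "i < n" "j < n" for i j
        using h(2)[OF that(1)] part_unique that by auto
      then have "(i, j) \<in> rho X n P u \<longleftrightarrow> i < n \<and> i = j" for i j
        using rho_iff[OF u(1)] u(3) h(3) by (auto split: if_splits)
      then show ?thesis
        by auto
    qed
    then have "u \<in> A_part X n P"
      using u(1) sym_group_graph[OF bij_betw_id, of "{..<n}"] unfolding A_part_iff by metis
    then have "u \<in> N"
      using N by blast
    have "infinite (P i - u `` X)" if i: "i < n" for i
    proof -
      have "P i - h i ` P i \<subseteq> P i - u `` X"
      proof
        fix y
        assume y: "y \<in> P i - h i ` P i"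
        have "y \<notin> u `` X"
        proof
          assume "y \<in> u `` X"
          then obtain j where j: "j < n" "y \<in> h j ` P j"
            using in_some_part u(3) by blast
          then have "j = i"
            using y h(2) part_unique[OF j(1) i, of y] by blast
          then show False
            using y j(2) by blast
        qed
        then show "y \<in> P i - u `` X"
          using y by blast
      qed
      then show ?thesis
        using h(4)[OF i] finite_subset by blast
    qed
    then have "N.absorbed (u `` X)"
      using N.coinfinite_absorbed[OF f, of "u `` X"] chart_ran[OF u(1)] by blast
    then have "N.absorbed X"
      using N.absorbed_pullback[OF \<open>u \<in> N\<close>, of X "u `` X"] u(2) by simp
    then obtain t where t: "t \<in> N" "X \<subseteq> Domain t" "t `` X \<subseteq> P 0"
      by (auto simp: N.absorbed_def)
    have t_chart: "t \<in> sym_inv_monoid X"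
      using t(1) by (rule N.M_chart)
    have "k \<in> N" if k: "k \<in> sym_inv_monoid X" for k
    proof -
      \<comment> \<open>The conjugate acts within \<open>P 0\<close>, so index 1 is absent from both
        sides of its \<open>rho\<close>, which places it in \<open>A_part\<close>.\<close>
      define k' where "k' = t\<inverse> O k O t"
      have chart: "k' \<in> sym_inv_monoid X"
        unfolding k'_def by (intro chart_comp chart_converse t_chart k)
      have "k' \<subseteq> P 0 \<times> P 0"
        using t(3) chart_dom[OF t_chart] unfolding k'_def by blast
      moreover have n: "0 < n" "1 < n"
        using two_le by auto
      then have "P 0 \<inter> P 1 = {}"
        using part_unique by fastforce
      ultimately have empty: "k' `` P 1 = {}" "k' `` A \<inter> P 1 = {}" for A
        by blast+
      have "1 \<notin> Domain (rho X n P k')" "1 \<notin> Range (rho X n P k')"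
        using rho_iff[OF chart] empty by auto
      then have "k' \<in> A_part X n P"
        using chart n(2) unfolding A_part_iff by blast
      then have "t O k' O t\<inverse> \<in> N"
        using N N.M_comp[OF t(1) N.M_comp[OF _ N.M_converse[OF t(1)]]] by blast
      moreover have "t O k' O t\<inverse> = k"
      proof
        show "t O k' O t\<inverse> \<subseteq> k"
          using chart_inj[OF t_chart] unfolding k'_def by blast
        show "k \<subseteq> t O k' O t\<inverse>"
        proof (rule subrelI)
          fix x y
          assume xy: "(x, y) \<in> k"
          then obtain x' y' where "(x, x') \<in> t" "(y, y') \<in> t"
            using t(2) chart_dom[OF k] chart_ran[OF k] by blast
          then show "(x, y) \<in> t O k' O t\<inverse>"
            using xy unfolding k'_def by blast
        qed
      qed
      ultimately show "k \<in> N"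
        by simp
    qed
    then show False
      using N by (auto simp: inverse_subsemigroup_def)
  qed
qed

section \<open>Uniqueness\<close>

definition balanced :: "('a set \<Rightarrow> bool) \<Rightarrow> 'a set \<Rightarrow> 'a rel set" where
  "balanced small X = {f \<in> sym_inv_monoid X. small (X - Domain f) \<longleftrightarrow> small (X - Range f)}"

text \<open>Both for \<open>small A \<longleftrightarrow> A = {}\<close> and for \<open>small = finite\<close>, the balanced charts form a proper
  inverse subsemigroup containing \<open>Sym(X)\<close>, so they cannot contain \<open>M\<close>.\<close>

lemma (in moiety_partition) unbalanced_chart:
  assumes M: "maximal_inverse_subsemigroup X M" "\<not> sym_group X \<subseteq> M"
    and small: "small {}" "\<And>A. small A \<Longrightarrow> finite A"
      "\<And>A B. small A \<Longrightarrow> B \<subseteq> A \<Longrightarrow> small B" "\<And>A B. small A \<Longrightarrow> small B \<Longrightarrow> small (A \<union> B)"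
      "\<And>f A. f \<in> sym_inv_monoid X \<Longrightarrow> small A \<Longrightarrow> small (f `` A)"
  obtains t where "t \<in> M" "small (X - Domain t)" "\<not> small (X - Range t)"
proof -
  \<comment> \<open>One implication suffices for products: the other follows by applying it to the
    inverses in reverse order. Smallness of complements travels from the domain of \<open>f\<close>
    to its range, then to the domain and range of \<open>g\<close>, because charts preserve small
    sets.\<close>
  have half: "small (X - Range (f O g)) \<and> small (X - Range f) \<and> small (X - Domain g)"
    if f: "f \<in> sym_inv_monoid X" and g: "g \<in> sym_inv_monoid X"
      and bal: "small (X - Domain f) \<Longrightarrow> small (X - Range f)"
        "small (X - Domain g) \<Longrightarrow> small (X - Range g)"
      and fg: "small (X - Domain (f O g))" for f g
  proof -
    have "small (X - Domain f)"
      by (rule small(3)[OF fg]) blast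
    then have f_ran: "small (X - Range f)"
      by (rule bal(1))
    have "X - Domain g \<subseteq> (X - Range f) \<union> f `` (X - Domain (f O g))"
    proof
      fix y
      assume y: "y \<in> X - Domain g"
      show "y \<in> (X - Range f) \<union> f `` (X - Domain (f O g))"
      proof (cases "y \<in> Range f")
        case True
        then obtain x where x: "(x, y) \<in> f"
          by blast
        have "x \<notin> Domain (f O g)"
          using y x chart_fun[OF f] by blast
        then show ?thesis
          using x chart_dom[OF f x] by blast
      qed (use y in blast)
    qed
    then have g_dom: "small (X - Domain g)"
      by (rule small(3)[OF small(4)[OF f_ran small(5)[OF f fg]]])
    have "X - Range (f O g) \<subseteq> (X - Range g) \<union> g `` (X - Range f)"
    proof
      fix z
      assume z: "z \<in> X - Range (f O g)"
      show "z \<in> (X - Range g) \<union> g `` (X - Range f)"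
      proof (cases "z \<in> Range g")
        case True
        then obtain y where y: "(y, z) \<in> g"
          by blast
        then have "y \<notin> Range f"
          using z by blast
        then show ?thesis
          using y chart_dom[OF g y] by blast
      qed (use z in blast)
    qed
    then have "small (X - Range (f O g))"
      by (rule small(3)[OF small(4)[OF bal(2)[OF g_dom] small(5)[OF g f_ran]]])
    then show ?thesis
      using f_ran g_dom by blast
  qed
  have balanced_iff: "f \<in> balanced small X \<longleftrightarrow>
      f \<in> sym_inv_monoid X \<and> (small (X - Domain f) \<longleftrightarrow> small (X - Range f))" for f
    by (simp add: balanced_def)
  have "inverse_subsemigroup X (balanced small X)"
    unfolding inverse_subsemigroup_def
  proof (intro conjI ballI)
    fix f g
    assume fg: "f \<in> balanced small X" "g \<in> balanced small X"
    then have charts: "f \<in> sym_inv_monoid X" "g \<in> sym_inv_monoid X"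
      by (simp_all add: balanced_iff)
    have "small (X - Domain (f O g)) \<Longrightarrow> small (X - Range (f O g))"
      using half[OF charts] fg unfolding balanced_iff by blast
    moreover have "small (X - Range (f O g)) \<Longrightarrow> small (X - Domain (f O g))"
      using half[OF chart_converse[OF charts(2)] chart_converse[OF charts(1)]] fg
      unfolding balanced_iff converse_relcomp[symmetric] Domain_converse Range_converse by blast
    ultimately show "f O g \<in> balanced small X"
      using chart_comp[OF charts] unfolding balanced_iff by blast
  next
    fix f
    assume "f \<in> balanced small X"
    then show "f\<inverse> \<in> balanced small X"
      using chart_converse[of f X] by (simp add: balanced_iff)
  qed (auto simp: balanced_def)
  moreover have "balanced small X \<noteq> sym_inv_monoid X"
  proof
    assume all: "balanced small X = sym_inv_monoid X"
    \<comment> \<open>A bijection of \<open>X\<close> onto a coinfinite subset is unbalanced: the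
      empty set is small, an infinite one is not.\<close>
    obtain B where B: "B \<subseteq> X" "infinite B" "infinite (X - B)"
      using infinite_split[OF infinite_X] by metis
    obtain h where h: "bij_betw h X B"
      using countable_infinite_bij_betw[OF countable_X infinite_X
          countable_subset[OF B(1) countable_X] B(2)] by blast
    let ?f = "(\<lambda>x. (x, h x)) ` X"
    have "?f \<in> balanced small X"
      unfolding all using h B(1) by (intro chart_graph) (auto simp: bij_betw_def)
    moreover have "Domain ?f = X" "Range ?f = B"
      using h by (auto simp: bij_betw_def)
    ultimately show False
      using small(1,2) B(3) by (auto simp: balanced_iff)
  qed
  moreover have "sym_group X \<subseteq> balanced small X"
    using small(1) unfolding sym_group_def balanced_def by auto
  \<comment> \<open>Otherwise maximality would make \<open>M\<close> equal to the balanced charts,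
    which include the symmetric group.\<close>
  ultimately have "\<not> M \<subseteq> balanced small X"
    using M unfolding maximal_inverse_subsemigroup_def by blast
  moreover have subM: "inverse_subsemigroup X M"
    using M(1) by (simp add: maximal_inverse_subsemigroup_def)
  ultimately obtain f where f: "f \<in> M" "small (X - Domain f) \<noteq> small (X - Range f)"
    using inverse_subsemigroupD(1)[OF subM] balanced_iff by blast
  show thesis
  \<comment> \<open>An unbalanced chart has a small complement on exactly one side; inversion makes
    it the domain side.\<close>
  proof (cases "small (X - Domain f)")
    case True
    then show ?thesis
      using that f by blast
  next
    case False
    then show ?thesis
      using that[of "f\<inverse>"] f inverse_subsemigroupD(3)[OF subM f(1)] by simp
  qed
qed

section \<open>From coinfinite sets to a cofinite set, and from there to \<open>X\<close>\<close>

context stab_semigroup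
begin

text \<open>If \<open>u\<close> misses infinitely many points of one part, then so does \<open>u s u\<close> for a second part,
  where \<open>s\<close> moves the missing points into the domain of a restriction of \<open>u\<close>.\<close>

lemma cofinite_absorbed:
  assumes coinf: "\<And>D. D \<subseteq> X \<Longrightarrow> (\<And>i. i < n \<Longrightarrow> infinite (P i - D)) \<Longrightarrow> absorbed D"
    and u: "u \<in> M" "finite (X - Domain u)" "infinite (X - Range u)"
  obtains D where "D \<subseteq> X" "absorbed D" "finite (X - D)"
proof -
  \<comment> \<open>\<open>L u\<close> collects the parts in which \<open>u\<close> misses
    infinitely many points. The induction enlarges it until it contains every index, and then
    \<open>coinf\<close> applies to the range of \<open>u\<close>.\<close>
  define L where "L u = {p\<in>{..<n}. infinite (P p - Range u)}" for u :: "'a rel"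
  have "\<exists>D\<subseteq>X. absorbed D \<and> finite (X - D)" if "u \<in> M" "finite (X - Domain u)" "L u \<noteq> {}" for u
    using that
  proof (induction "n - card (L u)" arbitrary: u rule: less_induct)
    case less
    have chart: "u \<in> sym_inv_monoid X"
      using less.prems(1) by (rule M_chart)
    have Ran: "Range u \<subseteq> X" and Dom: "Domain u \<subseteq> X"
      using chart_ran[OF chart] chart_dom[OF chart] by blast+
    show ?case
    proof (cases "L u = {..<n}")
      case True
      then have "absorbed (Range u)"
        using Ran by (intro coinf) (auto simp: L_def)
      then have "absorbed (Domain u)"
        by (rule absorbed_pullback[OF less.prems(1) subset_refl, rotated]) blast
      then show ?thesis
        using Dom less.prems(2) by blast
    next
      case False
      then obtain p where p: "p < n" "p \<notin> L u"
        by (auto simp: L_def)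
      obtain l where l: "l < n" "infinite (P l - Range u)"
        using less.prems(3) by (auto simp: L_def)
      \<comment> \<open>As \<open>p\<close> is not in \<open>L u\<close>, the range of
        \<open>u\<close> fills \<open>P p\<close> up to finitely many points. So infinitely many
        points go into \<open>P p\<close>, and infinitely many of these come from a single part
        \<open>P k\<close>.\<close>
      have "P p = (P p - Range u) \<union> (Range u \<inter> P p)"
        by blast
      moreover have "finite (P p - Range u)"
        using p by (simp add: L_def)
      ultimately have "infinite (Range u \<inter> P p)"
        using infinite_part[OF p(1)] by (metis finite_Un)
      moreover have "Range u \<inter> P p = u `` X \<inter> P p"
        using Dom by blast
      ultimately have "infinite (X \<inter> u\<inverse> `` P p)"
        using infinite_chart_Image_Int[OF chart] by simp
      then obtain k where k: "k < n" "infinite (X \<inter> u\<inverse> `` P p \<inter> P k)"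
        using infinite_meets_part by (metis inf_le1)
      \<comment> \<open>Half of the missed points are set aside, so that \<open>A\<close> is
        coinfinite in \<open>P l\<close> and can be moved by the stabiliser.\<close>
      obtain A where A: "A \<subseteq> P l - Range u" "infinite A" "infinite (P l - Range u - A)"
        using infinite_split[OF l(2)] by metis
      have "infinite (P l - A)"
        using A(3) finite_subset[of "P l - Range u - A" "P l - A"] by blast
      then obtain s where s: "s \<in> Stab X n P" "s `` A \<subseteq> X \<inter> u\<inverse> `` P p \<inter> P k"
        using stab_moving_one[OF l(1) k(1) _ _ _ k(2), of A] A(1) by blast
      have s_M: "s \<in> M" and s_chart: "s \<in> sym_inv_monoid X" and s_dom: "Domain s = X"
        using stab_in_M[OF s(1)] M_chart[OF stab_in_M[OF s(1)]] stab_Domain[OF s(1)] .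
      define v where "v = u O s O u"
      have v: "v \<in> M"
        unfolding v_def by (intro M_comp less.prems(1) s_M)
      \<comment> \<open>\<open>v\<close> is undefined only where the first or the second application
        of \<open>u\<close> fails, which is at finitely many points.\<close>
      have "X - Domain v \<subseteq> (X - Domain u) \<union> (u O s)\<inverse> `` (X - Domain u)"
      proof
        fix x
        assume x: "x \<in> X - Domain v"
        show "x \<in> (X - Domain u) \<union> (u O s)\<inverse> `` (X - Domain u)"
        proof (cases "x \<in> Domain u")
          case True
          then obtain y z where yz: "(x, y) \<in> u" "(y, z) \<in> s"
            using Ran s_dom by blast
          then have "z \<notin> Domain u"
            using x unfolding v_def by blast
          then show ?thesis
            using yz chart_ran[OF s_chart] by blast
        qed (use x in blast)
      qed
      moreover have "finite ((u O s)\<inverse> `` (X - Domain u))"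
        by (rule finite_chart_Image[OF chart_converse[OF chart_comp[OF chart s_chart]] less.prems(2)])
      ultimately have v_dom: "finite (X - Domain v)"
        using less.prems(2) finite_subset by blast
      have sub: "L u \<subseteq> L v"
      proof
        fix q
        assume q: "q \<in> L u"
        have "P q - Range u \<subseteq> P q - Range v"
          unfolding v_def by blast
        then show "q \<in> L v"
          using q finite_subset unfolding L_def by blast
      qed
      \<comment> \<open>Points of \<open>A\<close> are not reached by the first \<open>u\<close>, so
        by injectivity their images under \<open>s\<close> and the second \<open>u\<close> are
        missed by \<open>v\<close>; these images lie in \<open>P p\<close>.\<close>
      have "u `` s `` A \<subseteq> P p - Range v"
      proof
        fix z
        assume "z \<in> u `` s `` A"
        then obtain a y where ay: "a \<in> A" "(a, y) \<in> s" "(y, z) \<in> u"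
          by blast
        have "z \<in> P p"
          using ay s(2) chart_fun[OF chart] by blast
        moreover have "z \<notin> Range v"
        proof
          assume "z \<in> Range v"
          then obtain a' y' where "a' \<in> Range u" "(a', y') \<in> s" "(y', z) \<in> u"
            unfolding v_def by blast
          then have "a \<in> Range u"
            using ay chart_inj[OF chart] chart_inj[OF s_chart] by blast
          then show False
            using ay(1) A(1) by blast
        qed
        ultimately show "z \<in> P p - Range v"
          by blast
      qed
      moreover have "infinite (u `` s `` A)"
      proof (rule infinite_chart_Image[OF chart infinite_chart_Image[OF s_chart A(2)]])
        show "A \<subseteq> Domain s"
          using A(1) part_subset[OF l(1)] s_dom by blast
        show "s `` A \<subseteq> Domain u"
          using s(2) by blast
      qed
      ultimately have "infinite (P p - Range v)"
        using finite_subset by blast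
      then have "p \<in> L v"
        using p(1) by (simp add: L_def)
      then have "L u \<subset> L v"
        using sub p(2) by blast
      moreover have "L v \<subseteq> {..<n}"
        by (auto simp: L_def)
      ultimately have "card (L u) < card (L v)" "card (L v) \<le> n"
        using psubset_card_mono[of "L v" "L u"] card_mono[of "{..<n}" "L v"] finite_subset by auto
      then have "n - card (L v) < n - card (L u)"
        by linarith
      moreover have "L v \<noteq> {}"
        using \<open>p \<in> L v\<close> by blast
      ultimately show ?thesis
        using less.hyps v v_dom by blast
    qed
  qed
  moreover have "L u \<noteq> {}"
  proof -
    obtain p where "p < n" "infinite ((X - Range u) \<inter> P p)"
      using infinite_meets_part[OF u(3)] by blast
    moreover have "(X - Range u) \<inter> P p \<subseteq> P p - Range u"
      by blast
    ultimately show ?thesis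
      using finite_subset unfolding L_def by blast
  qed
  ultimately show thesis
    using that u(1,2) by blast
qed

text \<open>Follow \<open>t\<close> by a stabiliser element taking a point missed by
  \<open>t\<close> to a point \<open>x\<close> outside \<open>D\<close>. The resulting total chart
  \<open>m\<close> misses \<open>x\<close>, so it embeds the complement of the preimage
  \<open>E\<close> of \<open>D\<close> into the complement of \<open>D\<close> without
  \<open>x\<close>. Thus \<open>E\<close> is absorbed and leaves out fewer points.\<close>

lemma absorbed_X:
  assumes t: "t \<in> M" "Domain t = X" "Range t \<noteq> X"
    and D: "D \<subseteq> X" "absorbed D" "finite (X - D)"
  shows "absorbed X"
  using D
proof (induction "card (X - D)" arbitrary: D rule: less_induct)
  case less
  have chart: "t \<in> sym_inv_monoid X"
    using t(1) by (rule M_chart)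
  show ?case
  proof (cases "D = X")
    case False
    then obtain x where x: "x \<in> X" "x \<notin> D"
      using less.prems(1) by blast
    obtain y where y: "y \<in> X" "y \<notin> Range t"
      using t(3) chart_ran[OF chart] by blast
    obtain s where s: "s \<in> Stab X n P" "(y, x) \<in> s"
      using stab_moving_point[OF y(1) x(1)] by blast
    have s_M: "s \<in> M" and s_chart: "s \<in> sym_inv_monoid X" and s_dom: "Domain s = X"
      using stab_in_M[OF s(1)] M_chart[OF stab_in_M[OF s(1)]] stab_Domain[OF s(1)] .
    define m where "m = t O s"
    have m: "m \<in> M"
      unfolding m_def by (rule M_comp[OF t(1) s_M])
    have m_chart: "m \<in> sym_inv_monoid X"
      using m by (rule M_chart)
    have m_dom: "Domain m = X"
      using t(2) s_dom chart_ran[OF chart] chart_dom[OF m_chart] unfolding m_def by blast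
    have x_m: "x \<notin> Range m"
      using y(2) s(2) chart_inj[OF s_chart] unfolding m_def by blast
    define E where "E = m\<inverse> `` D"
    have "m `` E \<subseteq> D"
      using chart_fun[OF m_chart] unfolding E_def by blast
    moreover have E: "E \<subseteq> X"
      using chart_dom[OF m_chart] unfolding E_def by blast
    ultimately have "absorbed E"
      using absorbed_pullback[OF m, of E D] less.prems(2) m_dom by simp
    obtain g where g: "\<And>z. z \<in> Domain m \<Longrightarrow> (z, g z) \<in> m" "inj_on g (Domain m)"
      "g ` Domain m = Range m"
      using chart_function[OF m_chart] by blast
    have g_im: "g ` (X - E) \<subseteq> (X - D) - {x}"
    proof
      fix w
      assume "w \<in> g ` (X - E)"
      then obtain z where z: "w = g z" "z \<in> X" "z \<notin> E"
        by blast
      then have "(z, w) \<in> m"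
        using g(1) m_dom by blast
      then show "w \<in> (X - D) - {x}"
        using z(3) x_m chart_ran[OF m_chart] unfolding E_def by blast
    qed
    have g_inj: "inj_on g (X - E)"
      using g(2) m_dom inj_on_subset by blast
    have "finite (X - D - {x})"
      using less.prems(3) by simp
    then have "finite (X - E)" "card (X - E) \<le> card (X - D - {x})"
      using inj_on_finite[OF g_inj g_im] card_inj_on_le[OF g_inj g_im] by simp_all
    moreover have "card (X - D - {x}) < card (X - D)"
      using x less.prems(3) by (intro card_Diff1_less) auto
    ultimately show ?thesis
      using less.hyps[of E] E \<open>absorbed E\<close> by simp
  qed (use less.prems in simp)
qed

end

lemma (in moiety_partition) maximal_subset_A_part:
  assumes M: "maximal_inverse_subsemigroup X M" "Stab X n P \<subseteq> M" "\<not> sym_group X \<subseteq> M"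
  shows "M \<subseteq> A_part X n P"
proof
  interpret stab_semigroup X n P M
    by standard (use M in \<open>auto simp: maximal_inverse_subsemigroup_def\<close>)
  fix f
  assume "f \<in> M"
  show "f \<in> A_part X n P"
  proof (rule ccontr)
    assume f: "f \<notin> A_part X n P"
    obtain u where u: "u \<in> M" "finite (X - Domain u)" "infinite (X - Range u)"
      using unbalanced_chart[OF M(1,3), of finite] finite_chart_Image finite_subset by blast
    obtain D where D: "D \<subseteq> X" "absorbed D" "finite (X - D)"
      using cofinite_absorbed[OF coinfinite_absorbed[OF \<open>f \<in> M\<close> f] u] by blast
    \<comment> \<open>Smallness, taken as finiteness for \<open>u\<close>, now means emptiness: this
      gives a total chart that is not surjective.\<close>
    obtain t where t: "t \<in> M" "X - Domain t = {}" "X - Range t \<noteq> {}"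
      by (rule unbalanced_chart[OF M(1,3), of "\<lambda>A. A = {}"]) auto
    have "Domain t = X" "Range t \<noteq> X"
      using t(2,3) chart_dom[OF M_chart[OF t(1)]] by blast+
    then have "absorbed X"
      using absorbed_X[OF t(1) _ _ D] by blast
    then show False
      using absorbed_X_imp_sym_group M(3) by blast
  qed
qed

theorem corollary3p49:
  fixes X :: "'a set" and n :: nat and P :: "nat \<Rightarrow> 'a set"
  assumes "countable X" and "infinite X"
    and "n \<ge> 2" and "is_partition X n P"
    and "\<forall>i<n. P i \<approx> X"
  shows "(\<exists>!M. maximal_inverse_subsemigroup X M \<and> Stab X n P \<subseteq> M \<and> \<not> sym_group X \<subseteq> M) \<and>
    (maximal_inverse_subsemigroup X (A_part X n P) \<and>
      Stab X n P \<subseteq> A_part X n P \<and> \<not> sym_group X \<subseteq> A_part X n P)"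
proof -
  interpret moiety_partition X n P
    by standard (use assms eqpoll_finite_iff in auto)
  have unique: "M = A_part X n P"
    if M: "maximal_inverse_subsemigroup X M" "Stab X n P \<subseteq> M" "\<not> sym_group X \<subseteq> M" for M
  proof -
    \<comment> \<open>Since \<open>A_part\<close> is proper, maximality of \<open>M\<close> turns
      the inclusion of \<open>M\<close> in it into equality.\<close>
    have "A_part X n P \<noteq> sym_inv_monoid X"
      using A_part_maximal by (simp add: maximal_inverse_subsemigroup_def)
    then show ?thesis
      using M(1) maximal_subset_A_part[OF M] A_part_inverse_subsemigroup
      unfolding maximal_inverse_subsemigroup_def by blast
  qed
  show ?thesis
    using A_part_maximal Stab_subset_A_part sym_group_not_subset_A_part unique by blast
qed

end
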